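(* Let $X$ be a Hadamard manifold and $\mathbb{P}$ a Borel probability measure on $X$. If $\mathbb{P}$ is horospherically symmetric about a unique point $\theta\in X$ (i.e. $\theta$ is the only point of $X$ about which $\mathbb{P}$ is horospherically symmetric), then $\mu_*(\mathbb{P})=\{\theta\}$.
   Context: A Hadamard manifold is a complete simply connected finite-dimensional Riemannian manifold of nonpositive sectional curvature, with Riemannian distance $d(\cdot,\cdot)$. Its visual boundary $\partial X$ is the set of equivalence classes $\gamma(\infty)$ of unit-speed geodesic rays $\gamma:[0,\infty)\to X$, where $\gamma,\gamma'$ are equivalent if $\sup_{t\ge0}d(\gamma(t),\gamma'(t))<\infty$. Fix an origin $o\in X$. For $\xi\in\partial X$ the Busemann function is $B_\xi(x):=\lim_{t\to\infty}(d(\gamma(t),x)-t)$, where $\gamma$ is the unique unit-speed geodesic ray with $\gamma(0)=o$, $\gamma(\infty)=\xi$ (another choice of $o$ changes $B_\xi$ by an additive constant). For $z\in X$ let $H^+_{\xi,z}:=\{x\in X:B_\xi(x)\ge B_\xi(z)\}$. The horospherical depth is $D(z;\mathbb{P}):=\inf_{\xi\in\partial X}\mathbb{P}(H^+_{\xi,z})$, and the Busemann median is the set $\mu_*(\mathbb{P}):=\arg\max_{z\in X}D(z;\mathbb{P})$. $\mathbb{P}$ is horospherically symmetric about $\theta\in X$ if $\mathbb{P}(H^+_{\xi,\theta})\ge 1/2$ for every $\xi\in\partial X$. *)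

theory Defs
  imports "HOL-Probability.Probability"
begin

section \<open>Smooth functions of \<open>n\<close> real variables\<close>

text \<open>Points of \<open>n\<close>-space are the elements of \<^term>\<open>topspace (Euclidean_space n)\<close>, i.e. functions
  \<^typ>\<open>nat \<Rightarrow> real\<close> vanishing at all indices \<open>i \<ge> n\<close>; the dimension \<open>n = 0\<close> is included. Only
  the indices \<open>i < n\<close> of coordinates, tangent vectors and tensors are ever meaningful.\<close>

definition partial_deriv :: "nat \<Rightarrow> ((nat \<Rightarrow> real) \<Rightarrow> real) \<Rightarrow> (nat \<Rightarrow> real) \<Rightarrow> real" where
  "partial_deriv i f x = deriv (\<lambda>t. f (x(i := t))) (x i)"

fun Ck_on :: "nat \<Rightarrow> nat \<Rightarrow> (nat \<Rightarrow> real) set \<Rightarrow> ((nat \<Rightarrow> real) \<Rightarrow> real) \<Rightarrow> bool" where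
  "Ck_on n 0 W f \<longleftrightarrow> continuous_map (subtopology (Euclidean_space n) W) euclideanreal f"
| "Ck_on n (Suc k) W f \<longleftrightarrow>
     continuous_map (subtopology (Euclidean_space n) W) euclideanreal f \<and>
     (\<forall>i<n. (\<forall>x\<in>W. (\<lambda>t. f (x(i := t))) differentiable (at (x i))) \<and>
            Ck_on n k W (partial_deriv i f))"

definition smooth_fun_on :: "nat \<Rightarrow> (nat \<Rightarrow> real) set \<Rightarrow> ((nat \<Rightarrow> real) \<Rightarrow> real) \<Rightarrow> bool" where
  "smooth_fun_on n W f \<longleftrightarrow> (\<forall>k. Ck_on n k W f)"


section \<open>Riemannian manifolds\<close>

text \<open>A chart is a pair of its domain \<open>U\<close> and the coordinate map \<open>\<phi>\<close>. In a chart \<open>c\<close> the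
  metric tensor is given by its components \<open>gcomp M c x i j\<close>, as functions of the coordinates
  \<open>x \<in> \<phi> ` U\<close>.\<close>

type_synonym 'a chart = "'a set \<times> ('a \<Rightarrow> nat \<Rightarrow> real)"

record 'a riem_struct =
  mtop :: "'a topology"
  mdim :: nat
  atlas :: "'a chart set"
  gcomp :: "'a chart \<Rightarrow> (nat \<Rightarrow> real) \<Rightarrow> nat \<Rightarrow> nat \<Rightarrow> real"

abbreviation points :: "'a riem_struct \<Rightarrow> 'a set" where
  "points M \<equiv> topspace (mtop M)"

definition chart_image :: "'a chart \<Rightarrow> (nat \<Rightarrow> real) set" where
  "chart_image c = snd c ` fst c"

definition transition :: "'a chart \<Rightarrow> 'a chart \<Rightarrow> (nat \<Rightarrow> real) \<Rightarrow> nat \<Rightarrow> real" where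
  "transition c d x = snd d (inv_into (fst c) (snd c) x)"

definition overlap :: "'a chart \<Rightarrow> 'a chart \<Rightarrow> (nat \<Rightarrow> real) set" where
  "overlap c d = snd c ` (fst c \<inter> fst d)"

definition smooth_manifold :: "'a riem_struct \<Rightarrow> bool" where
  "smooth_manifold M \<longleftrightarrow>
     Hausdorff_space (mtop M) \<and> second_countable (mtop M) \<and>
     points M = (\<Union>c\<in>atlas M. fst c) \<and>
     (\<forall>c\<in>atlas M.
        openin (mtop M) (fst c) \<and>
        openin (Euclidean_space (mdim M)) (chart_image c) \<and>
        homeomorphic_map (subtopology (mtop M) (fst c))
          (subtopology (Euclidean_space (mdim M)) (chart_image c)) (snd c)) \<and>
     (\<forall>c\<in>atlas M. \<forall>d\<in>atlas M. \<forall>i<mdim M.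
        smooth_fun_on (mdim M) (overlap c d) (\<lambda>x. transition c d x i))"

definition inner_at :: "'a riem_struct \<Rightarrow> 'a chart \<Rightarrow> (nat \<Rightarrow> real) \<Rightarrow> (nat \<Rightarrow> real) \<Rightarrow> (nat \<Rightarrow> real) \<Rightarrow> real" where
  "inner_at M c x u v = (\<Sum>i<mdim M. \<Sum>j<mdim M. gcomp M c x i j * u i * v j)"

text \<open>The last conjunct is the transformation law of a covariant 2-tensor, i.e. the local
  expressions define one tensor field on \<open>M\<close>.\<close>

definition riemannian_manifold :: "'a riem_struct \<Rightarrow> bool" where
  "riemannian_manifold M \<longleftrightarrow>
     smooth_manifold M \<and>
     (\<forall>c\<in>atlas M.
        (\<forall>i<mdim M. \<forall>j<mdim M. smooth_fun_on (mdim M) (chart_image c) (\<lambda>x. gcomp M c x i j)) \<and>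
        (\<forall>x\<in>chart_image c.
           (\<forall>i<mdim M. \<forall>j<mdim M. gcomp M c x i j = gcomp M c x j i) \<and>
           (\<forall>v. (\<exists>i<mdim M. v i \<noteq> 0) \<longrightarrow> inner_at M c x v v > 0))) \<and>
     (\<forall>c\<in>atlas M. \<forall>d\<in>atlas M. \<forall>x\<in>overlap c d. \<forall>i<mdim M. \<forall>j<mdim M.
        gcomp M c x i j =
          (\<Sum>k<mdim M. \<Sum>l<mdim M. gcomp M d (transition c d x) k l *
             partial_deriv i (\<lambda>y. transition c d y k) x *
             partial_deriv j (\<lambda>y. transition c d y l) x))"


section \<open>Riemannian distance\<close>

text \<open>\<open>C\<^sup>1\<close> on the closed interval \<open>I\<close>, with one-sided derivatives at the end points. For
  continuous \<open>\<gamma>\<close> the set \<open>J\<close> of parameters mapped into the chart is relatively open in \<open>I\<close>.\<close>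

definition C1_curve_on :: "'a riem_struct \<Rightarrow> real set \<Rightarrow> (real \<Rightarrow> 'a) \<Rightarrow> bool" where
  "C1_curve_on M I \<gamma> \<longleftrightarrow>
     continuous_map (top_of_set I) (mtop M) \<gamma> \<and>
     (\<forall>c\<in>atlas M. \<forall>i<mdim M. let J = {t\<in>I. \<gamma> t \<in> fst c} in
        \<exists>D. continuous_on J D \<and>
            (\<forall>t\<in>J. ((\<lambda>s. snd c (\<gamma> s) i) has_real_derivative D t) (at t within J)))"

definition piecewise_C1_curve :: "'a riem_struct \<Rightarrow> (real \<Rightarrow> 'a) \<Rightarrow> bool" where
  "piecewise_C1_curve M \<gamma> \<longleftrightarrow>
     pathin (mtop M) \<gamma> \<and>
     (\<exists>(m::nat) (s::nat \<Rightarrow> real). s 0 = 0 \<and> s m = 1 \<and>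
        (\<forall>j<m. s j < s (Suc j) \<and> C1_curve_on M {s j..s (Suc j)} \<gamma>))"

text \<open>By the transformation law, the speed does not depend on the chart chosen around \<open>\<gamma> t\<close>.\<close>

definition chart_around :: "'a riem_struct \<Rightarrow> 'a \<Rightarrow> 'a chart" where
  "chart_around M p = (SOME c. c \<in> atlas M \<and> p \<in> fst c)"

definition speed :: "'a riem_struct \<Rightarrow> (real \<Rightarrow> 'a) \<Rightarrow> real \<Rightarrow> real" where
  "speed M \<gamma> t =
     (let c = chart_around M (\<gamma> t); v = (\<lambda>i. deriv (\<lambda>s. snd c (\<gamma> s) i) t)
      in sqrt (inner_at M c (snd c (\<gamma> t)) v v))"

definition curve_length :: "'a riem_struct \<Rightarrow> (real \<Rightarrow> 'a) \<Rightarrow> real" where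
  "curve_length M \<gamma> = integral {0..1} (speed M \<gamma>)"

definition riem_dist :: "'a riem_struct \<Rightarrow> 'a \<Rightarrow> 'a \<Rightarrow> real" where
  "riem_dist M p q =
     Inf {curve_length M \<gamma> | \<gamma>. piecewise_C1_curve M \<gamma> \<and> \<gamma> 0 = p \<and> \<gamma> 1 = q}"


section \<open>Levi-Civita connection and sectional curvature\<close>

definition inverse_metric :: "'a riem_struct \<Rightarrow> 'a chart \<Rightarrow> (nat \<Rightarrow> real) \<Rightarrow> nat \<Rightarrow> nat \<Rightarrow> real" where
  "inverse_metric M c x = (SOME h. \<forall>i<mdim M. \<forall>j<mdim M.
     (\<Sum>k<mdim M. h i k * gcomp M c x k j) = (if i = j then 1 else 0))"

text \<open>\<open>christoffel M c k i j\<close> is \<open>\<Gamma>\<^sup>k\<^sub>i\<^sub>j\<close>, where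
  \<open>\<nabla>\<^bsub>\<partial>i\<^esub> \<partial>j = \<Sum>k. \<Gamma>\<^sup>k\<^sub>i\<^sub>j \<partial>k\<close> for the Levi-Civita connection.\<close>

definition christoffel :: "'a riem_struct \<Rightarrow> 'a chart \<Rightarrow> nat \<Rightarrow> nat \<Rightarrow> nat \<Rightarrow> (nat \<Rightarrow> real) \<Rightarrow> real" where
  "christoffel M c k i j x =
     (\<Sum>l<mdim M. inverse_metric M c x k l *
        (partial_deriv i (\<lambda>y. gcomp M c y j l) x
       + partial_deriv j (\<lambda>y. gcomp M c y i l) x
       - partial_deriv l (\<lambda>y. gcomp M c y i j) x)) / 2"

text \<open>\<open>riem_curv M c i j k l x\<close> is the coefficient of \<open>\<partial>l\<close> in \<open>R(\<partial>i, \<partial>j) \<partial>k\<close>, with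
  \<open>R(u, v) w = \<nabla>\<^sub>u \<nabla>\<^sub>v w - \<nabla>\<^sub>v \<nabla>\<^sub>u w - \<nabla>\<^bsub>[u,v]\<^esub> w\<close>; for this sign convention the sectional
  curvature of \<open>u, v\<close> has numerator \<open>\<langle>R(u, v) v, u\<rangle>\<close>.\<close>

definition riem_curv :: "'a riem_struct \<Rightarrow> 'a chart \<Rightarrow> nat \<Rightarrow> nat \<Rightarrow> nat \<Rightarrow> nat \<Rightarrow> (nat \<Rightarrow> real) \<Rightarrow> real" where
  "riem_curv M c i j k l x =
     partial_deriv i (christoffel M c l j k) x - partial_deriv j (christoffel M c l i k) x
     + (\<Sum>m<mdim M. christoffel M c m j k x * christoffel M c l i m x
                  - christoffel M c m i k x * christoffel M c l j m x)"

definition sectional_curvature ::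
  "'a riem_struct \<Rightarrow> 'a chart \<Rightarrow> (nat \<Rightarrow> real) \<Rightarrow> (nat \<Rightarrow> real) \<Rightarrow> (nat \<Rightarrow> real) \<Rightarrow> real" where
  "sectional_curvature M c x u v =
     inner_at M c x
       (\<lambda>l. \<Sum>i<mdim M. \<Sum>j<mdim M. \<Sum>k<mdim M. riem_curv M c i j k l x * u i * v j * v k) u
     / (inner_at M c x u u * inner_at M c x v v - (inner_at M c x u v)\<^sup>2)"

definition lin_indep_pair :: "nat \<Rightarrow> (nat \<Rightarrow> real) \<Rightarrow> (nat \<Rightarrow> real) \<Rightarrow> bool" where
  "lin_indep_pair n u v \<longleftrightarrow> (\<forall>a b. (\<forall>i<n. a * u i + b * v i = 0) \<longrightarrow> a = 0 \<and> b = 0)"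

definition nonpos_sectional_curvature :: "'a riem_struct \<Rightarrow> bool" where
  "nonpos_sectional_curvature M \<longleftrightarrow>
     (\<forall>c\<in>atlas M. \<forall>x\<in>chart_image c. \<forall>u v. lin_indep_pair (mdim M) u v \<longrightarrow>
        sectional_curvature M c x u v \<le> 0)"


section \<open>Hadamard manifolds\<close>

text \<open>The library notion of simple connectedness is for subsets of a type with a topology; this is
  its analogue for an abstract topology, with homotopies relative to the base point.\<close>

definition simply_connected_top :: "'a topology \<Rightarrow> bool" where
  "simply_connected_top T \<longleftrightarrow>
     path_connected_space T \<and>
     (\<forall>p. pathin T p \<and> p 1 = p 0 \<longrightarrow>
        homotopic_with (\<lambda>q. q 0 = p 0 \<and> q 1 = p 0) (top_of_set {0..1}) T p (\<lambda>_. p 0))"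

definition hadamard_manifold :: "'a riem_struct \<Rightarrow> bool" where
  "hadamard_manifold M \<longleftrightarrow>
     riemannian_manifold M \<and> points M \<noteq> {} \<and>
     simply_connected_top (mtop M) \<and>
     Metric_space.mcomplete (points M) (riem_dist M) \<and>
     nonpos_sectional_curvature M"


section \<open>Visual boundary and Busemann functions\<close>

text \<open>Unit-speed solutions of the geodesic equation on \<open>[0,\<infinity>)\<close>; \<open>v\<close> and \<open>w\<close> are the first and
  second derivatives of \<open>\<gamma>\<close> in the chart \<open>c\<close>. Rays are made extensional so that two rays are equal
  as soon as they agree on \<open>[0,\<infinity>)\<close>.\<close>

definition geodesic_ray :: "'a riem_struct \<Rightarrow> (real \<Rightarrow> 'a) \<Rightarrow> bool" where
  "geodesic_ray M \<gamma> \<longleftrightarrow>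
     \<gamma> \<in> extensional {0..} \<and>
     continuous_map (top_of_set {0..}) (mtop M) \<gamma> \<and>
     (\<forall>c\<in>atlas M. let J = {t\<in>{0..}. \<gamma> t \<in> fst c} in
        \<exists>v w. \<forall>t\<in>J.
          inner_at M c (snd c (\<gamma> t)) (v t) (v t) = 1 \<and>
          (\<forall>k<mdim M.
             ((\<lambda>s. snd c (\<gamma> s) k) has_real_derivative v t k) (at t within J) \<and>
             ((\<lambda>s. v s k) has_real_derivative w t k) (at t within J) \<and>
             w t k + (\<Sum>i<mdim M. \<Sum>j<mdim M.
                        christoffel M c k i j (snd c (\<gamma> t)) * v t i * v t j) = 0))"

definition asymptotic :: "'a riem_struct \<Rightarrow> ((real \<Rightarrow> 'a) \<times> (real \<Rightarrow> 'a)) set" where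
  "asymptotic M = {(\<gamma>, \<gamma>'). geodesic_ray M \<gamma> \<and> geodesic_ray M \<gamma>' \<and>
     bdd_above ((\<lambda>t. riem_dist M (\<gamma> t) (\<gamma>' t)) ` {0..})}"

definition visual_boundary :: "'a riem_struct \<Rightarrow> (real \<Rightarrow> 'a) set set" where
  "visual_boundary M = {\<gamma>. geodesic_ray M \<gamma>} // asymptotic M"

definition ray_from :: "'a riem_struct \<Rightarrow> 'a \<Rightarrow> (real \<Rightarrow> 'a) set \<Rightarrow> real \<Rightarrow> 'a" where
  "ray_from M orig \<xi> = (THE \<gamma>. \<gamma> \<in> \<xi> \<and> \<gamma> 0 = orig)"

definition busemann :: "'a riem_struct \<Rightarrow> 'a \<Rightarrow> (real \<Rightarrow> 'a) set \<Rightarrow> 'a \<Rightarrow> real" where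
  "busemann M orig \<xi> x = Lim at_top (\<lambda>t. riem_dist M (ray_from M orig \<xi> t) x - t)"

definition upper_horo :: "'a riem_struct \<Rightarrow> 'a \<Rightarrow> (real \<Rightarrow> 'a) set \<Rightarrow> 'a \<Rightarrow> 'a set" where
  "upper_horo M orig \<xi> z = {x \<in> points M. busemann M orig \<xi> x \<ge> busemann M orig \<xi> z}"


section \<open>Horospherical depth and the Busemann median\<close>

definition borel_prob_on :: "'a topology \<Rightarrow> 'a measure \<Rightarrow> bool" where
  "borel_prob_on T P \<longleftrightarrow>
     prob_space P \<and> space P = topspace T \<and> sets P = sigma_sets (topspace T) {U. openin T U}"

text \<open>The boundary is empty only when \<open>M\<close> is a single point. Then \<^term>\<open>Inf {} :: real\<close> is an
  unspecified constant, which does not affect the set of maximisers.\<close>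

definition horo_depth :: "'a riem_struct \<Rightarrow> 'a \<Rightarrow> 'a measure \<Rightarrow> 'a \<Rightarrow> real" where
  "horo_depth M orig P z = (INF \<xi>\<in>visual_boundary M. measure P (upper_horo M orig \<xi> z))"

definition busemann_median :: "'a riem_struct \<Rightarrow> 'a \<Rightarrow> 'a measure \<Rightarrow> 'a set" where
  "busemann_median M orig P = {z. is_arg_max (horo_depth M orig P) (\<lambda>z. z \<in> points M) z}"

definition horo_symmetric :: "'a riem_struct \<Rightarrow> 'a \<Rightarrow> 'a measure \<Rightarrow> 'a \<Rightarrow> bool" where
  "horo_symmetric M orig P \<theta> \<longleftrightarrow>
     (\<forall>\<xi>\<in>visual_boundary M. measure P (upper_horo M orig \<xi> \<theta>) \<ge> 1/2)"

end

theory Submission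
  imports Defs
begin

text \<open>The number \<open>1/2\<close> separates \<open>\<theta>\<close> from all other points. The Busemann superlevel sets
  through \<open>\<theta>\<close> all have mass at least \<open>1/2\<close>, hence so does their infimum, the depth of \<open>\<theta>\<close>.
  About any other point symmetry fails, so a single superlevel set there of mass below \<open>1/2\<close>
  already forces the depth below \<open>1/2\<close>. The first bound needs a boundary point; with an empty
  boundary every point is vacuously a point of symmetry, so uniqueness makes \<open>\<theta>\<close> the only
  point.\<close>

lemma horo_symmetric_imp_depth_ge_half:
  assumes "visual_boundary X \<noteq> {}" and "horo_symmetric X orig P z"
  shows "1/2 \<le> horo_depth X orig P z"
  unfolding horo_depth_def
  using assms by (intro cINF_greatest) (auto simp: horo_symmetric_def)

lemma not_horo_symmetric_imp_depth_less_half: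
  assumes "\<not> horo_symmetric X orig P z"
  shows "horo_depth X orig P z < 1/2"
proof -
  obtain \<xi> where \<xi>: "\<xi> \<in> visual_boundary X" "measure P (upper_horo X orig \<xi> z) < 1/2"
    using assms by (auto simp: horo_symmetric_def not_le)
  have "bdd_below ((\<lambda>\<xi>. measure P (upper_horo X orig \<xi> z)) ` visual_boundary X)"
    by (rule bdd_belowI2[where m = 0]) simp
  then have "horo_depth X orig P z \<le> measure P (upper_horo X orig \<xi> z)"
    unfolding horo_depth_def using \<xi>(1) by (rule cINF_lower)
  with \<xi>(2) show ?thesis by simp
qed

theorem proposition4p6:
  fixes X :: "'a riem_struct" and orig \<theta> :: 'a and P :: "'a measure"
  assumes "hadamard_manifold X"
    and "orig \<in> points X"
    and "borel_prob_on (mtop X) P"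
    and "\<theta> \<in> points X"
    and "horo_symmetric X orig P \<theta>"
    and "\<And>z. z \<in> points X \<Longrightarrow> horo_symmetric X orig P z \<Longrightarrow> z = \<theta>"
  shows "busemann_median X orig P = {\<theta>}"
proof -
  have less: "horo_depth X orig P z < horo_depth X orig P \<theta>"
    if z: "z \<in> points X" "z \<noteq> \<theta>" for z
  proof -
    have asym: "\<not> horo_symmetric X orig P z"
      using assms(6) z by blast
    \<comment> \<open>The failure of symmetry at \<open>z\<close> supplies the boundary point.\<close>
    then have "visual_boundary X \<noteq> {}"
      by (auto simp: horo_symmetric_def)
    then have "1/2 \<le> horo_depth X orig P \<theta>"
      using assms(5) by (rule horo_symmetric_imp_depth_ge_half)
    with not_horo_symmetric_imp_depth_less_half[OF asym] show ?thesis
      by (rule less_le_trans)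
  qed
  have "is_arg_max (horo_depth X orig P) (\<lambda>z. z \<in> points X) z \<longleftrightarrow> z = \<theta>" for z
    unfolding is_arg_max_def using less assms(4) by (metis less_asym order_less_irrefl)
  then show ?thesis
    by (simp add: busemann_median_def)
qed

end
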